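(* Let $\sigma=\sigma(1)\sigma(2)\cdots\sigma(n)$ be a permutation of $\{1,2,\ldots,n\}$. Then $\sigma$ is a short Catalan--Spitzer permutation (i.e., a short $2$-Catalan--Spitzer permutation of order $n$) if and only if its Foata--Strehl tree $\mathcal{FS}(\sigma)$ is levelwise numbered. Moreover, for an integer $k\geq 2$, $\sigma$ is a short $k$-Catalan--Spitzer permutation (of some order) if and only if $\mathcal{FS}(\sigma)$ is levelwise numbered and, in addition, every maximal path in $\mathcal{FS}(\sigma)$ all of whose edges join a vertex to its right child (a single vertex counting as such a path when it has no right child and is not the right child of its parent) has a number of vertices that is a multiple of $k-1$.
   Context: Let $k\geq 2$, $n\geq 0$. A $k$-Catalan--Spitzer path of order $n$ is a lattice path $(0,z'_0),(1,z'_1),\ldots,(kn+1,z'_{kn+1})$ with $z'_0=z'_{kn+1}=0$, consisting of $(k-1)n+1$ up steps $(1,n)$ and $n$ down steps $(1,-((k-1)n+1))$, such that $z'_i>0$ for $1\leq i\leq kn$. Given such a path, let $i_1<i_2<\cdots<i_{(k-1)n}$ be the indices $i\in\{1,\ldots,kn\}$ with $z'_i<z'_{i+1}$ (there are exactly $(k-1)n$ of them). The short $k$-Catalan--Spitzer permutation of the path is the permutation $\sigma$ of $\{1,\ldots,(k-1)n\}$ with $\sigma(a)<\sigma(b)$ iff $z'_{i_a}<z'_{i_b}$. For $k=2$ these are called short Catalan--Spitzer permutations (of order $n$, permutations of $\{1,\ldots,n\}$). A plane $0$-$1$-$2$ tree is a rooted tree in which each vertex has at most one left child and at most one right child. The Foata--Strehl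 tree $\mathcal{FS}(w_1\cdots w_m)$ of a word with distinct letters from an ordered alphabet is defined recursively: its root is labeled $w_i=\min(w_1,\ldots,w_m)$, the left subtree of the root is $\mathcal{FS}(w_1\cdots w_{i-1})$ (absent if $i=1$), and the right subtree is $\mathcal{FS}(w_{i+1}\cdots w_m)$ (absent if $i=m$); vertices are labeled by the letters. The level of a vertex of a plane $0$-$1$-$2$ tree is the number of steps from a parent to its right child on the unique path from the root to the vertex. A plane $0$-$1$-$2$ tree with vertices labeled bijectively by $1,\ldots,m$ is levelwise numbered if: (1) whenever the level of the vertex labeled $i$ is less than the level of the vertex labeled $j$, then $i<j$; (2) whenever the vertex labeled $j$ is in the left subtree of the vertex labeled $i$, then $i<j$; (3) whenever the vertices labeled $i$ and $j$ have the same level and there is a label $l<i,j$ such that the vertex labeled $i$ is in the right subtree and the vertex labeled $j$ is in the left subtree of the vertex labeled $l$, then $i<j$. *)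

theory Defs
  imports Main "HOL-Library.Tree" "HOL-Library.Sublist" "HOL-Combinatorics.Multiset_Permutations"
begin

text \<open>
  A path is given by the list of its heights \<open>z'\<^sub>0, \<dots>, z'\<^bsub>kn+1\<^esub>\<close>. The two step counts pin down
  the number of steps of each kind; the kinds never coincide, not even for \<open>n = 0\<close>, because only
  a down step decreases the height.
\<close>

definition up_step :: "nat \<Rightarrow> int list \<Rightarrow> nat \<Rightarrow> bool" where
  "up_step n z i \<longleftrightarrow> z ! Suc i = z ! i + int n"

definition down_step :: "nat \<Rightarrow> nat \<Rightarrow> int list \<Rightarrow> nat \<Rightarrow> bool" where
  "down_step k n z i \<longleftrightarrow> z ! Suc i = z ! i - int ((k - 1) * n + 1)"

definition catalan_spitzer_path :: "nat \<Rightarrow> nat \<Rightarrow> int list \<Rightarrow> bool" where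
  "catalan_spitzer_path k n z \<longleftrightarrow>
     length z = k * n + 2 \<and> z ! 0 = 0 \<and> z ! (k * n + 1) = 0 \<and>
     (\<forall>i < k * n + 1. up_step n z i \<or> down_step k n z i) \<and>
     card {i. i < k * n + 1 \<and> up_step n z i} = (k - 1) * n + 1 \<and>
     card {i. i < k * n + 1 \<and> down_step k n z i} = n \<and>
     (\<forall>i \<in> {1..k * n}. z ! i > 0)"

definition ascent_indices :: "nat \<Rightarrow> nat \<Rightarrow> int list \<Rightarrow> nat list" where
  "ascent_indices k n z = filter (\<lambda>i. z ! i < z ! Suc i) [1..<k * n + 1]"

text \<open>
  Permutations are words in one-line notation, so \<open>\<sigma>(a)\<close> is \<open>\<sigma> ! (a - 1)\<close>, and \<open>i\<^sub>a\<close> is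
  \<open>ascent_indices k n z ! (a - 1)\<close>.
\<close>

definition short_permutation_of_path :: "nat \<Rightarrow> nat \<Rightarrow> int list \<Rightarrow> nat list \<Rightarrow> bool" where
  "short_permutation_of_path k n z \<sigma> \<longleftrightarrow>
     \<sigma> \<in> permutations_of_set {1..(k - 1) * n} \<and>
     (\<forall>a < (k - 1) * n. \<forall>b < (k - 1) * n.
        \<sigma> ! a < \<sigma> ! b \<longleftrightarrow>
        z ! (ascent_indices k n z ! a) < z ! (ascent_indices k n z ! b))"

definition short_catalan_spitzer_permutation :: "nat \<Rightarrow> nat \<Rightarrow> nat list \<Rightarrow> bool" where
  "short_catalan_spitzer_permutation k n \<sigma> \<longleftrightarrow>
     (\<exists>z. catalan_spitzer_path k n z \<and> short_permutation_of_path k n z \<sigma>)"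

text \<open>
  A plane 0-1-2 tree is an \<open>'a tree\<close>, where \<open>Leaf\<close> stands for an absent subtree and the
  vertices are the \<open>Node\<close>s.
\<close>

function foata_strehl :: "'a::linorder list \<Rightarrow> 'a tree" where
  "foata_strehl w =
     (if w = [] then Leaf
      else let m = Min (set w) in
        Node (foata_strehl (takeWhile (\<lambda>x. x \<noteq> m) w)) m
             (foata_strehl (tl (dropWhile (\<lambda>x. x \<noteq> m) w))))"
  by pat_completeness auto
termination
proof (relation "measure length")
  fix w :: "'a list" and m
  assume w: "w \<noteq> []" and m: "m = Min (set w)"
  from w m have "m \<in> set w" by simp
  then have ne: "dropWhile (\<lambda>x. x \<noteq> m) w \<noteq> []" by (simp add: dropWhile_eq_Nil_conv)
  have len: "length (takeWhile (\<lambda>x. x \<noteq> m) w) + length (dropWhile (\<lambda>x. x \<noteq> m) w) = length w"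
    by (metis length_append takeWhile_dropWhile_id)
  from ne have "length (dropWhile (\<lambda>x. x \<noteq> m) w) > 0" by simp
  with len show "(takeWhile (\<lambda>x. x \<noteq> m) w, w) \<in> measure length"
    and "(tl (dropWhile (\<lambda>x. x \<noteq> m) w), w) \<in> measure length"
    unfolding in_measure length_tl by linarith+
qed auto

declare foata_strehl.simps [simp del]

text \<open>
  A vertex is identified with the sequence of left/right steps leading to it from the root, so
  \<open>v\<close> lies in the left (right) subtree of \<open>u\<close> iff \<open>u @ [L]\<close> (\<open>u @ [R]\<close>) is a prefix of \<open>v\<close>.
\<close>

datatype dir = L | R

fun subtree_at :: "'a tree \<Rightarrow> dir list \<Rightarrow> 'a tree" where
  "subtree_at t [] = t"
| "subtree_at t (L # p) = subtree_at (left t) p"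
| "subtree_at t (R # p) = subtree_at (right t) p"

definition vertices :: "'a tree \<Rightarrow> dir list set" where
  "vertices t = {p. subtree_at t p \<noteq> Leaf}"

definition label :: "'a tree \<Rightarrow> dir list \<Rightarrow> 'a" where
  "label t p = value (subtree_at t p)"

definition level :: "dir list \<Rightarrow> nat" where
  "level p = count_list p R"

definition in_left_subtree :: "dir list \<Rightarrow> dir list \<Rightarrow> bool" where
  "in_left_subtree v u \<longleftrightarrow> prefix (u @ [L]) v"

definition in_right_subtree :: "dir list \<Rightarrow> dir list \<Rightarrow> bool" where
  "in_right_subtree v u \<longleftrightarrow> prefix (u @ [R]) v"

definition levelwise_numbered :: "nat tree \<Rightarrow> bool" where
  "levelwise_numbered t \<longleftrightarrow>
     bij_betw (label t) (vertices t) {1..card (vertices t)} \<and>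
     (\<forall>u \<in> vertices t. \<forall>v \<in> vertices t. level u < level v \<longrightarrow> label t u < label t v) \<and>
     (\<forall>u \<in> vertices t. \<forall>v \<in> vertices t. in_left_subtree v u \<longrightarrow> label t u < label t v) \<and>
     (\<forall>u \<in> vertices t. \<forall>v \<in> vertices t.
        level u = level v \<and>
        (\<exists>w \<in> vertices t. label t w < label t u \<and> label t w < label t v \<and>
           in_right_subtree u w \<and> in_left_subtree v w)
        \<longrightarrow> label t u < label t v)"

definition right_path :: "'a tree \<Rightarrow> dir list list \<Rightarrow> bool" where
  "right_path t vs \<longleftrightarrow>
     vs \<noteq> [] \<and> set vs \<subseteq> vertices t \<and> successively (\<lambda>u v. v = u @ [R]) vs"

definition maximal_right_path :: "'a tree \<Rightarrow> dir list list \<Rightarrow> bool" where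
  "maximal_right_path t vs \<longleftrightarrow>
     right_path t vs \<and> \<not> (\<exists>ws. right_path t ws \<and> set vs \<subset> set ws)"

end

theory Submission
  imports Defs
begin

text \<open>
  Write \<open>q = k - 1\<close>. Before the last down step, a path that has made \<open>a + 1\<close> up steps and \<open>d\<close> down
  steps is at height \<open>m (a + 1 - q d) - d\<close> with \<open>0 \<le> d < m\<close>. Hence heights are compared first by
  \<open>h = a - q d\<close>, the height in a Dyck path with down steps of size \<open>q\<close>, and for equal
  \<open>h\<close> from right to left. On the other hand, the levels of the vertices of a plane 0-1-2 tree, read in inorder, are
  the heights of the up steps of a Dyck path, and levelwise numbering is again numbering by level and,
  within a level, from right to left. The minimum of the word is the last up step at height 0, so
  the recursion of the Foata--Strehl tree is the last-return decomposition of the path, and the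
  levels of the tree are the heights \<open>h\<close>. Finally, the heights come from a path with down steps of
  size \<open>q\<close> iff \<open>h\<^sub>i \<equiv> i\<close> modulo \<open>q\<close>, which is a divisibility condition on the right spines
  of all left subtrees.
\<close>

subsection \<open>Foata--Strehl trees\<close>

lemma foata_strehl_Nil [simp]: "foata_strehl [] = Leaf"
  by (simp add: foata_strehl.simps)

text \<open>Trades the recursion through \<open>Min\<close>, \<open>takeWhile\<close> and
  \<open>dropWhile\<close> for a split at a letter below all others.\<close>

lemma foata_strehl_append:
  assumes "\<forall>x \<in> set ls. m < x" "\<forall>x \<in> set rs. m < x"
  shows "foata_strehl (ls @ m # rs) = Node (foata_strehl ls) m (foata_strehl rs)"
proof -
  have min: "Min (set (ls @ m # rs)) = m"
    using assms by (intro Min_eqI) (auto intro: less_imp_le)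
  have "takeWhile (\<lambda>x. x \<noteq> m) (ls @ m # rs) = ls" "dropWhile (\<lambda>x. x \<noteq> m) (ls @ m # rs) = m # rs"
    using assms by (auto simp: takeWhile_append dropWhile_append dest: less_imp_neq)
  with min show ?thesis
    by (subst foata_strehl.simps) (simp add: Let_def)
qed

text \<open>Follows the recursion of the Foata--Strehl tree; distinctness makes the minimum strict,
  as \<open>foata_strehl_append\<close> requires.\<close>

lemma distinct_min_split_induct [consumes 1, case_names Nil split]:
  fixes w :: "'a::linorder list"
  assumes "distinct w" "P []"
    and split: "\<And>ls m rs. distinct (ls @ m # rs) \<Longrightarrow> \<forall>x \<in> set ls. m < x \<Longrightarrow> \<forall>x \<in> set rs. m < x \<Longrightarrow>
      P ls \<Longrightarrow> P rs \<Longrightarrow> P (ls @ m # rs)"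
  shows "P w"
  using assms(1)
proof (induction w rule: length_induct)
  case (1 w)
  show ?case
  proof (cases "w = []")
    case False
    then have "Min (set w) \<in> set w" by simp
    then obtain ls rs where w: "w = ls @ Min (set w) # rs" by (meson split_list)
    define m where "m = Min (set w)"
    have w': "w = ls @ m # rs" using w m_def by simp
    have le: "\<forall>x \<in> set w. m \<le> x" using m_def by simp
    have d: "distinct (ls @ m # rs)" using 1(2) w' by simp
    have "\<forall>x \<in> set ls. m < x" "\<forall>x \<in> set rs. m < x" using le d w' by (force simp: less_le)+
    moreover have "P ls" "P rs" using 1(1) d w' by auto
    ultimately show ?thesis unfolding w' using d split by blast
  qed (use assms(2) in simp)
qed

lemma inorder_foata_strehl: "distinct w \<Longrightarrow> inorder (foata_strehl w) = w"
  by (induction w rule: distinct_min_split_induct) (simp_all add: foata_strehl_append)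

lemma set_tree_foata_strehl: "distinct w \<Longrightarrow> set_tree (foata_strehl w) = set w"
  by (metis inorder_foata_strehl set_inorder)

lemma heap_foata_strehl: "distinct w \<Longrightarrow> heap (foata_strehl w)"
  by (induction w rule: distinct_min_split_induct)
    (auto simp: foata_strehl_append set_tree_foata_strehl intro: less_imp_le)

subsection \<open>Vertices in inorder\<close>

fun inorder_vertices :: "'a tree \<Rightarrow> dir list list" where
  "inorder_vertices Leaf = []"
| "inorder_vertices (Node l a r) =
     map (Cons L) (inorder_vertices l) @ [] # map (Cons R) (inorder_vertices r)"

fun levels :: "'a tree \<Rightarrow> nat list" where
  "levels Leaf = []"
| "levels (Node l a r) = levels l @ 0 # map Suc (levels r)"

text \<open>The inorder on addresses, stated without reference to a tree.\<close>

fun precedes :: "dir list \<Rightarrow> dir list \<Rightarrow> bool" where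
  "precedes (L # p) (L # q) = precedes p q"
| "precedes (R # p) (R # q) = precedes p q"
| "precedes (L # p) q = True"
| "precedes [] (R # q) = True"
| "precedes p q = False"

lemma subtree_at_Leaf [simp]: "subtree_at Leaf p = Leaf"
  by (induction "Leaf :: 'a tree" p rule: subtree_at.induct) auto

lemma subtree_at_append: "subtree_at t (p @ q) = subtree_at (subtree_at t p) q"
  by (induction t p rule: subtree_at.induct) auto

lemma vertices_Leaf [simp]: "vertices Leaf = {}"
  by (simp add: vertices_def)

lemma in_vertices_Node [simp]:
  "[] \<in> vertices (Node l a r)"
  "L # p \<in> vertices (Node l a r) \<longleftrightarrow> p \<in> vertices l"
  "R # p \<in> vertices (Node l a r) \<longleftrightarrow> p \<in> vertices r"
  by (simp_all add: vertices_def)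

lemma label_Node [simp]:
  "label (Node l a r) [] = a"
  "label (Node l a r) (L # p) = label l p"
  "label (Node l a r) (R # p) = label r p"
  by (simp_all add: label_def)

lemma level_simps [simp]:
  "level [] = 0" "level (L # p) = level p" "level (R # p) = Suc (level p)"
  "level (p @ q) = level p + level q"
  by (simp_all add: level_def)

lemma vertices_appendD: "p @ q \<in> vertices t \<Longrightarrow> p \<in> vertices t"
  by (auto simp: vertices_def subtree_at_append)

lemma vertices_Node:
  "vertices (Node l a r) = insert [] (Cons L ` vertices l \<union> Cons R ` vertices r)"
proof (intro set_eqI)
  fix p
  show "p \<in> vertices (Node l a r) \<longleftrightarrow> p \<in> insert [] (Cons L ` vertices l \<union> Cons R ` vertices r)"
  proof (cases p)
    case (Cons d p')
    then show ?thesis by (cases d) auto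
  qed simp
qed

lemma set_inorder_vertices: "set (inorder_vertices t) = vertices t"
  by (induction t) (auto simp: vertices_Node)

lemma map_label_inorder_vertices: "map (label t) (inorder_vertices t) = inorder t"
  by (induction t) (auto simp: comp_def)

lemma map_level_inorder_vertices: "map level (inorder_vertices t) = levels t"
  by (induction t) (auto simp: comp_def dest: arg_cong[where f = "map Suc"])

lemma length_levels [simp]: "length (levels t) = size t"
  by (induction t) auto

lemma precedes_asym: "precedes p q \<Longrightarrow> \<not> precedes q p"
  by (induction p q rule: precedes.induct) auto

lemma sorted_precedes_inorder_vertices: "sorted_wrt precedes (inorder_vertices t)"
  by (induction t) (auto simp: sorted_wrt_append sorted_wrt_map)

text \<open>Two addresses are comparable or branch at their longest common prefix. This expresses
  inorder through the subtree relations that occur in the conditions of levelwise numbering.\<close>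

lemma precedes_iff:
  "precedes u v \<longleftrightarrow> in_left_subtree u v \<or> in_right_subtree v u \<or>
     (\<exists>w. in_left_subtree u w \<and> in_right_subtree v w)"
proof
  assume "precedes u v"
  then show "in_left_subtree u v \<or> in_right_subtree v u \<or>
     (\<exists>w. in_left_subtree u w \<and> in_right_subtree v w)"
  proof (induction u v rule: precedes.induct)
    case (1 p q)
    then show ?case
      unfolding in_left_subtree_def in_right_subtree_def
      by simp (metis append_Cons prefix_code(3) same_prefix_nil Cons_prefix_Cons)
  next
    case (2 p q)
    then show ?case
      unfolding in_left_subtree_def in_right_subtree_def
      by simp (metis append_Cons Cons_prefix_Cons)
  next
    case ("3_2" p q)
    then show ?case
      unfolding in_left_subtree_def in_right_subtree_def
      by (metis append_Nil Cons_prefix_Cons Nil_prefix)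
  qed (auto simp: in_left_subtree_def in_right_subtree_def)
next
  have left: "precedes (u @ L # p) u" and right: "precedes u (u @ R # p)"
    and both: "precedes (u @ L # p) (u @ R # q)" for u p q
  proof -
    have "precedes (u @ p) (u @ q) = precedes p q" for p q
    proof (induction u)
      case (Cons d u)
      then show ?case by (cases d) auto
    qed simp
    from this[of "L # p" "[]"] this[of "[]" "R # p"] this[of "L # p" "R # q"]
    show "precedes (u @ L # p) u" "precedes u (u @ R # p)" "precedes (u @ L # p) (u @ R # q)"
      by simp_all
  qed
  assume "in_left_subtree u v \<or> in_right_subtree v u \<or>
     (\<exists>w. in_left_subtree u w \<and> in_right_subtree v w)"
  then show "precedes u v"
    using left right both by (auto simp: in_left_subtree_def in_right_subtree_def prefix_def)
qed

lemma label_in_set_tree: "p \<in> vertices t \<Longrightarrow> label t p \<in> set_tree t"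
  by (metis image_eqI list.set_map map_label_inorder_vertices set_inorder set_inorder_vertices)

lemma heap_label_le:
  assumes "heap t" "p @ q \<in> vertices t"
  shows "label t p \<le> label t (p @ q)"
  using assms
proof (induction t arbitrary: p)
  case (Node l a r)
  show ?case
  proof (cases p)
    case Nil
    have "a \<le> label (Node l a r) q"
      using label_in_set_tree[of q "Node l a r"] Node.prems Nil by auto
    then show ?thesis using Nil by simp
  next
    case (Cons d p')
    then show ?thesis using Node by (cases d) auto
  qed
qed simp

subsection \<open>Words ranked by heights\<close>

text \<open>
  For distinct letters this says that the word sorts its positions by increasing height, positions
  of equal height being sorted from right to left.
\<close>

definition ranked :: "'a::linorder list \<Rightarrow> nat list \<Rightarrow> bool" where
  "ranked w h \<longleftrightarrow> length w = length h \<and> sorted_wrt (\<lambda>(s, x) (t, y). s < t \<longleftrightarrow> x < y) (zip w h)"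

text \<open>Heights at which the up steps of a Dyck path start, with baseline \<open>c\<close>:
  between consecutive up steps the path only falls, so these heights rise by at most one.\<close>

definition dyck_heights :: "nat \<Rightarrow> nat list \<Rightarrow> bool" where
  "dyck_heights c h \<longleftrightarrow>
     successively (\<lambda>x y. y \<le> Suc x) h \<and> (h \<noteq> [] \<longrightarrow> hd h = c) \<and> (\<forall>x \<in> set h. c \<le> x)"

lemma ranked_iff_nth:
  "ranked w h \<longleftrightarrow> length w = length h \<and>
     (\<forall>j < length w. \<forall>i < j. w ! i < w ! j \<longleftrightarrow> h ! i < h ! j)"
  by (auto simp: ranked_def sorted_wrt_iff_nth_less)

text \<open>At the root the levels drop to 0, and those of the right subtree, raised by one, start
  at 1, so both junctions are admissible.\<close>

lemma dyck_heights_levels: "dyck_heights 0 (levels t)"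
  unfolding dyck_heights_def
proof (induction t)
  case (Node l a r)
  have "successively (\<lambda>x y. y \<le> Suc x) (map Suc (levels r))"
    using Node by (simp add: successively_map)
  then show ?case
    using Node by (cases "levels r = []")
      (auto simp: successively_append_iff successively_Cons hd_append hd_map)
qed simp

text \<open>The least letter sits at the last visit to the baseline, so the recursion of the tree is
  the last-return decomposition. The baseline \<open>c\<close> is general because the right part
  lives one level higher.\<close>

lemma levels_foata_strehl:
  assumes "distinct w" "ranked w h" "dyck_heights c h"
  shows "map ((+) c) (levels (foata_strehl w)) = h"
  using assms
proof (induction w arbitrary: h c rule: distinct_min_split_induct)
  case Nil
  then show ?case by (simp add: ranked_def)
next
  case (split ls m rs)
  have "length h = length ls + Suc (length rs)" using split.prems by (simp add: ranked_def)
  then obtain hl x hr where h: "h = hl @ x # hr" "length hl = length ls" "length hr = length rs"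
    by (metis (no_types, lifting) length_Suc_conv append_take_drop_id length_drop
          add_diff_cancel_left' length_take min.absorb2 le_add1)
  have rk: "ranked ls hl" "ranked rs hr"
    and lm: "\<forall>(s, y) \<in> set (zip ls hl). s < m \<longleftrightarrow> y < x"
    and mr: "\<forall>(s, y) \<in> set (zip rs hr). m < s \<longleftrightarrow> x < y"
    using split.prems(1) h by (auto simp: ranked_def sorted_wrt_append)
  \<comment> \<open>The first letter of a nonempty \<open>ls\<close> is not below \<open>m\<close>,
    so ranking forbids its height \<open>c\<close> to be below \<open>x\<close>.\<close>
  have x: "x = c"
  proof (cases hl)
    case Nil
    then show ?thesis using split.prems(2) h by (simp add: dyck_heights_def)
  next
    case (Cons y hl')
    then obtain s ls' where ls: "ls = s # ls'" using h by (cases ls) auto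
    have "y = c" "c \<le> x" using split.prems(2) h Cons by (auto simp: dyck_heights_def)
    moreover have "\<not> s < m" using split.hyps ls by auto
    then have "\<not> y < x" using lm ls Cons by auto
    ultimately show ?thesis by simp
  qed
  \<comment> \<open>Letters to the right of \<open>m\<close> exceed it, and by ranking a larger
    letter further right is strictly higher.\<close>
  have gt: "\<forall>y \<in> set hr. c < y"
  proof
    fix y assume "y \<in> set hr"
    then obtain s where "(s, y) \<in> set (zip rs hr)"
      using h(3) by (metis in_set_impl_in_set_zip2)
    then show "c < y" using mr x split.hyps by (auto dest: set_zip_leftD)
  qed
  have "dyck_heights c hl"
    using split.prems(2) h by (auto simp: dyck_heights_def successively_append_iff hd_append)
  moreover have "dyck_heights (Suc c) hr"
    using split.prems(2) h x gt
    by (cases hr) (auto simp: dyck_heights_def successively_append_iff successively_Cons)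
  ultimately have "map ((+) c) (levels (foata_strehl ls)) = hl"
    "map ((+) (Suc c)) (levels (foata_strehl rs)) = hr"
    using split.IH rk by blast+
  then show ?case
    using split.hyps h x by (auto simp: foata_strehl_append)
qed

text \<open>Both sides order vertices by level first. Within a level, \<open>ranked\<close> gives
  the smaller label to the later vertex in inorder; by \<open>precedes_iff\<close> this is what
  conditions (2) and (3) demand.\<close>

lemma levelwise_numbered_iff_ranked:
  assumes "w \<in> permutations_of_set {1..n}"
  defines "t \<equiv> foata_strehl w"
  shows "levelwise_numbered t \<longleftrightarrow> ranked w (levels t)"
proof -
  have w: "distinct w" "set w = {1..n}" using assms by (auto simp: permutations_of_set_def)
  define vs where "vs = inorder_vertices t"
  have lab: "map (label t) vs = w"
    using w by (simp add: vs_def t_def map_label_inorder_vertices inorder_foata_strehl)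
  have vs: "set vs = vertices t" by (simp add: vs_def set_inorder_vertices)
  have dist: "distinct vs" "inj_on (label t) (vertices t)"
    using w(1) lab vs distinct_map by metis+
  have lv: "map level vs = levels t" by (simp add: vs_def map_level_inorder_vertices)
  have "label t ` vertices t = {1..n}" using w lab vs by (metis list.set_map)
  moreover from this have "card (vertices t) = n"
    using dist(2) by (metis card_image card_atLeastAtMost diff_Suc_1)
  ultimately have bij: "bij_betw (label t) (vertices t) {1..card (vertices t)}"
    using dist(2) by (simp add: bij_betw_def)
  \<comment> \<open>Makes the branching vertex carry the smaller label \<open>l\<close> that
    condition (3) asks for.\<close>
  have heap: "label t p < label t v" if v: "v \<in> vertices t" "prefix (p @ [d]) v" for p d v
  proof -
    obtain q where q: "v = p @ d # q" using v(2) by (auto simp: prefix_def)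
    have "label t p \<le> label t v"
      using heap_label_le[of t p "d # q"] that q heap_foata_strehl w(1) t_def by auto
    moreover have "p \<in> vertices t" "p \<noteq> v" using that q vertices_appendD by auto
    ultimately show ?thesis using dist(2) that(1) by (metis inj_onD order_le_less)
  qed
  have "zip w (levels t) = map (\<lambda>v. (label t v, level v)) vs"
    by (simp flip: lab lv add: zip_map_map zip_same_conv_map)
  then have rk: "ranked w (levels t) \<longleftrightarrow>
      sorted_wrt (\<lambda>u v. label t u < label t v \<longleftrightarrow> level u < level v) vs"
    by (simp add: ranked_def sorted_wrt_map flip: lab lv)
  have level_left: "level u \<le> level v" if "in_left_subtree v u" for u v
    using that by (auto simp: in_left_subtree_def prefix_def)
  show ?thesis
  proof
    assume num: "levelwise_numbered t"
    have "label t u < label t v \<longleftrightarrow> level u < level v"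
      if uv: "u \<in> vertices t" "v \<in> vertices t" "precedes u v" for u v
    proof (cases "level u = level v")
      case False
      then show ?thesis using num uv unfolding levelwise_numbered_def
        by (metis linorder_neqE_nat order.asym)
    next
      case True
      \<comment> \<open>A right descendant has a larger level, so only two cases of
        \<open>precedes_iff\<close> remain.\<close>
      have "\<not> in_right_subtree v u"
        using True by (auto simp: in_right_subtree_def prefix_def)
      then consider "in_left_subtree u v" | w where "in_left_subtree u w" "in_right_subtree v w"
        using uv(3) precedes_iff by blast
      then have "label t v < label t u"
      proof cases
        case 1
        then show ?thesis using num uv by (auto simp: levelwise_numbered_def)
      next
        case (2 w)
        have "w \<in> vertices t"
          using 2(1) uv(1) vertices_appendD by (auto simp: in_left_subtree_def prefix_def)
        moreover have "label t w < label t u" "label t w < label t v"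
          using heap 2 uv by (auto simp: in_left_subtree_def in_right_subtree_def)
        ultimately show ?thesis
          using num[unfolded levelwise_numbered_def, THEN conjunct2, THEN conjunct2, THEN conjunct2]
            uv 2 True by metis
      qed
      then show ?thesis using True by simp
    qed
    then show "ranked w (levels t)"
      unfolding rk using sorted_precedes_inorder_vertices[of t] vs
      by (auto simp flip: vs_def intro: sorted_wrt_mono_rel[rotated])
  next
    assume "ranked w (levels t)"
    then have sorted: "sorted_wrt
        (\<lambda>u v. precedes u v \<and> (label t u < label t v \<longleftrightarrow> level u < level v)) vs"
      using sorted_precedes_inorder_vertices[of t] unfolding rk
      by (auto simp: sorted_wrt_iff_nth_less vs_def)
    \<comment> \<open>Distinct vertices occur in \<open>vs\<close> in one order or the other, which
      frees the sorted statement from list positions.\<close>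
    have tot: "precedes u v \<and> (label t u < label t v \<longleftrightarrow> level u < level v) \<or>
        precedes v u \<and> (label t v < label t u \<longleftrightarrow> level v < level u)"
      if uv: "u \<in> vertices t" "v \<in> vertices t" "u \<noteq> v" for u v
    proof -
      obtain i j where ij: "i < length vs" "j < length vs" "u = vs ! i" "v = vs ! j"
        using uv vs by (metis in_set_conv_nth)
      then consider "i < j" | "j < i" using uv(3) by (metis linorder_neqE_nat)
      then show ?thesis
        using sorted_wrt_nth_less[OF sorted, of i j] sorted_wrt_nth_less[OF sorted, of j i] ij
        by cases auto
    qed
    have 1: "label t u < label t v"
      if "u \<in> vertices t" "v \<in> vertices t" "level u < level v" for u v
      using tot[of u v] that dist(2) by (metis inj_onD linorder_neqE_nat order.asym)
    \<comment> \<open>If \<open>v\<close> comes first and is not lower than \<open>u\<close>,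
      ranking rules out that its label is smaller. This serves conditions (2) and (3) alike.\<close>
    have eq: "label t u < label t v"
      if "u \<in> vertices t" "v \<in> vertices t" "level u \<le> level v" "precedes v u" for u v
      using tot[of u v] that dist(2) precedes_asym by (metis inj_onD linorder_neqE_nat leD)
    show "levelwise_numbered t"
      unfolding levelwise_numbered_def
    proof (intro conjI ballI impI)
      fix u v assume uv: "u \<in> vertices t" "v \<in> vertices t"
      { assume "level u < level v" then show "label t u < label t v" using 1 uv by blast }
      { assume "in_left_subtree v u"
        then show "label t u < label t v" using eq uv level_left precedes_iff by blast }
      { assume "level u = level v \<and> (\<exists>w\<in>vertices t. label t w < label t u \<and> label t w < label t v \<and>
          in_right_subtree u w \<and> in_left_subtree v w)"
        then show "label t u < label t v" using eq uv precedes_iff by (metis order_refl) }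
    qed (use bij in simp)
  qed
qed

subsection \<open>Maximal right paths\<close>

fun right_spine :: "'a tree \<Rightarrow> nat" where
  "right_spine Leaf = 0"
| "right_spine (Node l a r) = Suc (right_spine r)"

lemma replicate_R_vertices_iff: "p @ replicate i R \<in> vertices t \<longleftrightarrow> i < right_spine (subtree_at t p)"
proof -
  have "replicate i R \<in> vertices s \<longleftrightarrow> i < right_spine s" for s :: "'a tree"
  proof (induction s arbitrary: i)
    case (Node l a r)
    then show ?case by (cases i) auto
  qed simp
  then show ?thesis by (simp add: vertices_def subtree_at_append)
qed

text \<open>Such a path is fixed by its first vertex and its length, and it fits into the tree as
  long as it stays on the right spine below that vertex.\<close>

lemma right_path_iff:
  "right_path t vs \<longleftrightarrow> (\<exists>p n. vs = map (\<lambda>i. p @ replicate i R) [0..<n] \<and>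
     0 < n \<and> n \<le> right_spine (subtree_at t p))"
proof -
  \<comment> \<open>Peeling off the first vertex moves the base point from \<open>p\<close> to
    \<open>p @ [R]\<close>, hence the generalisation over \<open>p\<close>.\<close>
  have succ: "successively (\<lambda>u v. v = u @ [R]) (p # us) \<longleftrightarrow>
      p # us = map (\<lambda>i. p @ replicate i R) [0..<Suc (length us)]" for p us
  proof (induction us arbitrary: p)
    case (Cons q us)
    have "map (\<lambda>i. p @ replicate i R) [0..<Suc (length (q # us))] =
        p # map (\<lambda>i. (p @ [R]) @ replicate i R) [0..<Suc (length us)]"
      by (subst upt_conv_Cons) (simp_all add: map_Suc_upt[symmetric] comp_def del: upt_Suc)
    moreover have "hd (map (\<lambda>i. (p @ [R]) @ replicate i R) [0..<Suc (length us)]) = p @ [R]"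
      by (subst upt_conv_Cons) simp_all
    then have "q # us = map (\<lambda>i. (p @ [R]) @ replicate i R) [0..<Suc (length us)] \<longleftrightarrow>
        q = p @ [R] \<and> q # us = map (\<lambda>i. q @ replicate i R) [0..<Suc (length us)]"
      by (metis list.sel(1))
    ultimately show ?case
      using Cons[of q] by (simp del: upt_Suc)
  qed simp
  show ?thesis
  proof
    assume rp: "right_path t vs"
    then obtain p us where vs: "vs = p # us" by (cases vs) (auto simp: right_path_def)
    then have eq: "vs = map (\<lambda>i. p @ replicate i R) [0..<Suc (length us)]"
      using rp succ by (simp add: right_path_def del: upt_Suc)
    have "p @ replicate (length us) R \<in> vertices t"
      using rp unfolding right_path_def by (subst (asm) (2) eq) auto
    then show "\<exists>p n. vs = map (\<lambda>i. p @ replicate i R) [0..<n] \<and>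
        0 < n \<and> n \<le> right_spine (subtree_at t p)"
      using eq by (metis replicate_R_vertices_iff Suc_le_eq zero_less_Suc)
  next
    assume "\<exists>p n. vs = map (\<lambda>i. p @ replicate i R) [0..<n] \<and>
      0 < n \<and> n \<le> right_spine (subtree_at t p)"
    then obtain p n where vs: "vs = map (\<lambda>i. p @ replicate i R) [0..<n]" "0 < n"
        "n \<le> right_spine (subtree_at t p)" by blast
    have "successively (\<lambda>u v. v = u @ [R]) vs"
      using vs(1,2) succ[of p "tl vs"] by (cases n) (auto simp: upt_conv_Cons simp del: upt_Suc)
    then show "right_path t vs"
      using vs by (auto simp: right_path_def replicate_R_vertices_iff)
  qed
qed

text \<open>A right path can grow only at its two ends: downwards unless it exhausts the spine,
  upwards unless its first vertex is the root or a left child.\<close>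

lemma maximal_right_path_iff:
  "maximal_right_path t vs \<longleftrightarrow>
     (\<exists>p. vs = map (\<lambda>i. p @ replicate i R) [0..<right_spine (subtree_at t p)] \<and>
     p \<in> vertices t \<and> (p = [] \<or> last p = L))"
proof
  assume max: "maximal_right_path t vs"
  then obtain p n where vs: "vs = map (\<lambda>i. p @ replicate i R) [0..<n]" "0 < n"
      "n \<le> right_spine (subtree_at t p)" by (auto simp: maximal_right_path_def right_path_iff)
  have nomax: "\<not> (right_path t ws \<and> set vs \<subset> set ws)" for ws
    using max by (auto simp: maximal_right_path_def)
  have n: "n = right_spine (subtree_at t p)"
  proof (rule ccontr)
    assume "n \<noteq> right_spine (subtree_at t p)"
    then have "right_path t (map (\<lambda>i. p @ replicate i R) [0..<Suc n])"
      using vs unfolding right_path_iff by (metis Suc_leI le_neq_implies_less zero_less_Suc)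
    moreover have "p @ replicate n R \<notin> set vs" using vs(1) by auto
    then have "set vs \<subset> set (map (\<lambda>i. p @ replicate i R) [0..<Suc n])"
      using vs(1) by auto
    ultimately show False using nomax by blast
  qed
  have "p = [] \<or> last p = L"
  proof (rule ccontr)
    assume "\<not> (p = [] \<or> last p = L)"
    then obtain p' where p: "p = p' @ [R]"
      by (metis append_butlast_last_id dir.exhaust)
    have "Suc n \<le> right_spine (subtree_at t p')"
      using n vs(2) by (cases "subtree_at t p'") (auto simp: p subtree_at_append)
    then have "right_path t (map (\<lambda>i. p' @ replicate i R) [0..<Suc n])"
      unfolding right_path_iff by blast
    moreover have "set vs \<subseteq> set (map (\<lambda>i. p' @ replicate i R) [0..<Suc n])"
      using vs(1) by (auto simp: p image_iff simp del: upt_Suc simp flip: replicate_Suc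
        intro!: bexI[where x = "Suc _"])
    moreover have "p' \<in> set (map (\<lambda>i. p' @ replicate i R) [0..<Suc n])" "p' \<notin> set vs"
      using vs(1) by (auto simp: p image_iff simp del: upt_Suc intro!: bexI[where x = 0])
    ultimately show False using nomax by blast
  qed
  then show "\<exists>p. vs = map (\<lambda>i. p @ replicate i R) [0..<right_spine (subtree_at t p)] \<and>
     p \<in> vertices t \<and> (p = [] \<or> last p = L)"
    using vs n replicate_R_vertices_iff[of p 0 t] by auto
next
  assume "\<exists>p. vs = map (\<lambda>i. p @ replicate i R) [0..<right_spine (subtree_at t p)] \<and>
     p \<in> vertices t \<and> (p = [] \<or> last p = L)"
  then obtain p where vs: "vs = map (\<lambda>i. p @ replicate i R) [0..<right_spine (subtree_at t p)]"
      and p: "p \<in> vertices t" "p = [] \<or> last p = L" by blast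
  have pos: "0 < right_spine (subtree_at t p)" using p(1) replicate_R_vertices_iff[of p 0 t] by simp
  show "maximal_right_path t vs"
    unfolding maximal_right_path_def
  proof (intro conjI notI)
    show "right_path t vs" using vs pos unfolding right_path_iff by blast
    assume "\<exists>ws. right_path t ws \<and> set vs \<subset> set ws"
    then obtain q n where q: "n \<le> right_spine (subtree_at t q)"
        and sub: "set vs \<subset> set (map (\<lambda>i. q @ replicate i R) [0..<n])"
      unfolding right_path_iff by blast
    \<comment> \<open>The larger path contains \<open>p\<close>; as \<open>p\<close> is not a right
      child, it must be the first vertex there, and the full spine leaves no room below.\<close>
    have "p \<in> set vs" using vs pos by (force intro!: bexI[where x = 0])
    then obtain i where i: "p = q @ replicate i R" using sub by auto
    then have "p = q" using p(2) by (cases i) (auto simp: last_append split: if_splits)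
    then have "set (map (\<lambda>i. q @ replicate i R) [0..<n]) \<subseteq> set vs" using vs q by auto
    then show False using sub by blast
  qed
qed

text \<open>One induction proves both claims: the root has level 0 at position
  \<open>size l\<close>, so the congruence there says \<open>q dvd size l\<close>, and the second
  claim converts this into divisibility of the right spine of \<open>l\<close>.\<close>

lemma left_spines_dvd_iff_levels_mod:
  "(\<forall>p. q dvd right_spine (subtree_at t (p @ [L]))) \<longleftrightarrow>
     (\<forall>i < size t. levels t ! i mod q = i mod q)"
  "(\<forall>i < size t. levels t ! i mod q = i mod q) \<Longrightarrow> right_spine t mod q = size t mod q"
proof (induction t)
  case (Node l a r)
  let ?good = "\<lambda>t. \<forall>p. q dvd right_spine (subtree_at t (p @ [L]))"
  let ?mod = "\<lambda>t. \<forall>i < size t. levels t ! i mod q = i mod q"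
  have allp: "(\<forall>p. P p) \<longleftrightarrow> P [] \<and> (\<forall>p. P (L # p)) \<and> (\<forall>p. P (R # p))" for P
    by (metis dir.exhaust list.exhaust)
  have good: "?good (Node l a r) \<longleftrightarrow> q dvd right_spine l \<and> ?good l \<and> ?good r"
    by (subst allp) simp
  have mod: "?mod (Node l a r) \<longleftrightarrow> ?mod l \<and> q dvd size l \<and> ?mod r"
  proof -
    have split: "(\<forall>i < a + Suc b. P i) \<longleftrightarrow> (\<forall>i < a. P i) \<and> P a \<and> (\<forall>i < b. P (a + Suc i))"
      for a b and P :: "nat \<Rightarrow> bool"
    proof (intro iffI conjI allI impI)
      fix i assume *: "(\<forall>i < a. P i) \<and> P a \<and> (\<forall>i < b. P (a + Suc i))" "i < a + Suc b"
      then consider "i < a" | "i = a" | "i = a + Suc (i - Suc a)" "i - Suc a < b" by linarith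
      then show "P i" using * by cases metis+
    qed auto
    have "?mod (Node l a r) \<longleftrightarrow> ?mod l \<and> 0 mod q = size l mod q \<and>
        (\<forall>i < size r. Suc (levels r ! i) mod q = (size l + Suc i) mod q)"
      using split[of "size l" "size r" "\<lambda>i. levels (Node l a r) ! i mod q = i mod q"]
      by (simp add: nth_append)
    \<comment> \<open>In the right subtree positions shift by \<open>size l + 1\<close> and levels
      by 1; modulo \<open>q\<close> these shifts agree once \<open>q dvd size l\<close>.\<close>
    moreover have "Suc x mod q = (size l + Suc y) mod q \<longleftrightarrow> x mod q = y mod q"
      if "q dvd size l" for x y
    proof -
      have "(size l + Suc y) mod q = Suc y mod q" using that by (auto elim!: dvdE)
      then show ?thesis by (simp add: mod_Suc)
    qed
    ultimately show ?thesis by (cases "q dvd size l") (simp, simp add: dvd_eq_mod_eq_0)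
  qed
  have "q dvd right_spine l \<longleftrightarrow> q dvd size l" if "?mod l"
    using Node.IH(2)[OF that] by (simp add: dvd_eq_mod_eq_0)
  then show "?good (Node l a r) \<longleftrightarrow> ?mod (Node l a r)"
    unfolding good mod Node.IH(1,3) by blast
  assume "?mod (Node l a r)"
  then have "q dvd size l" "right_spine r mod q = size r mod q" using mod Node.IH by blast+
  then show "right_spine (Node l a r) mod q = size (Node l a r) mod q"
    by (auto simp: mod_Suc_eq elim!: dvdE) (metis mod_Suc_eq mod_mult_self4 add_Suc_right)
qed auto

text \<open>The spine at the root is the one that does not belong to a left subtree; given the
  congruences, its divisibility is that of the size.\<close>

lemma maximal_right_paths_dvd_iff:
  "(\<forall>vs. maximal_right_path t vs \<longrightarrow> q dvd length vs) \<longleftrightarrow>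
     q dvd size t \<and> (\<forall>i < size t. levels t ! i mod q = i mod q)"
proof -
  have "(\<forall>vs. maximal_right_path t vs \<longrightarrow> q dvd length vs) \<longleftrightarrow>
      (\<forall>p \<in> vertices t. p = [] \<or> last p = L \<longrightarrow> q dvd right_spine (subtree_at t p))"
    by (auto simp: maximal_right_path_iff)
  \<comment> \<open>Outside the tree the right spine has length 0, which every \<open>q\<close>
    divides.\<close>
  also have "\<dots> \<longleftrightarrow> (\<forall>p. p = [] \<or> last p = L \<longrightarrow> q dvd right_spine (subtree_at t p))"
  proof -
    have "p \<notin> vertices t \<Longrightarrow> q dvd right_spine (subtree_at t p)" for p
      by (simp add: vertices_def)
    then show ?thesis by blast
  qed
  also have "\<dots> \<longleftrightarrow> q dvd right_spine t \<and> (\<forall>p. q dvd right_spine (subtree_at t (p @ [L])))"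
    by (metis append_butlast_last_id last_snoc subtree_at.simps(1))
  finally show ?thesis
    using left_spines_dvd_iff_levels_mod[where t = t and q = q] by (metis dvd_eq_mod_eq_0)
qed

subsection \<open>Heights of Catalan--Spitzer paths\<close>

text \<open>
  The height at which a path arrives after \<open>a + 1\<close> up steps and \<open>d\<close> down steps, where \<open>q = k - 1\<close>.
\<close>

definition spitzer_height :: "nat \<Rightarrow> nat \<Rightarrow> nat \<Rightarrow> nat \<Rightarrow> int" where
  "spitzer_height q m a d = int m * (int a + 1) - (int q * int m + 1) * int d"

text \<open>
  \<open>d a\<close> is the number of down steps of a path that precede its up step number \<open>a\<close>, where
  the initial up step is not counted.
\<close>

definition down_counts :: "nat \<Rightarrow> nat \<Rightarrow> (nat \<Rightarrow> nat) \<Rightarrow> bool" where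
  "down_counts q N d \<longleftrightarrow> (\<forall>a < N. q * d a \<le> a) \<and> (\<forall>b < N. \<forall>a < b. d a \<le> d b)"

lemma spitzer_height_eq:
  assumes "q * d \<le> a"
  shows "spitzer_height q m a d = int m * int (Suc (a - q * d)) - int d"
proof -
  obtain x where "a = q * d + x" using assms le_Suc_ex by blast
  then show ?thesis by (simp add: spitzer_height_def algebra_simps)
qed

lemma down_count_less:
  assumes "(q :: nat) * d \<le> a" "a < q * m"
  shows "d < m"
  using assms by (meson le_less_trans mult_less_cancel1)

text \<open>The gap of at least \<open>m\<close> between \<open>m * x\<close> and
  \<open>m * y\<close> cannot be closed by subtracting \<open>e < m\<close>.\<close>

lemma lex_less:
  fixes m x y d e :: int
  assumes "x < y" "0 \<le> d" "e < m" "0 < m"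
  shows "m * x - d < m * y - e"
proof -
  have "m * (x + 1) \<le> m * y" using assms by (intro mult_left_mono) auto
  then show ?thesis using assms by (simp add: algebra_simps)
qed

lemma spitzer_height_less_iff:
  assumes "down_counts q (q * m) d" "a < b" "b < q * m"
  shows "spitzer_height q m a (d a) < spitzer_height q m b (d b) \<longleftrightarrow> a - q * d a < b - q * d b"
    and "spitzer_height q m a (d a) \<noteq> spitzer_height q m b (d b)"
proof -
  define x y where xy: "x = a - q * d a" "y = b - q * d b"
  have le: "q * d a \<le> a" "q * d b \<le> b" "d a \<le> d b" using assms by (auto simp: down_counts_def)
  have lt: "d a < m" "d b < m" using le assms by (auto intro: down_count_less)
  note eq = spitzer_height_eq[OF le(1), of m, folded xy] spitzer_height_eq[OF le(2), of m, folded xy]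
  consider "x < y" | "y < x" | "x = y" by linarith
  then have "(spitzer_height q m a (d a) < spitzer_height q m b (d b) \<longleftrightarrow> x < y) \<and>
      spitzer_height q m a (d a) \<noteq> spitzer_height q m b (d b)"
  proof cases
    case 1
    then show ?thesis
      using lex_less[of "int (Suc x)" "int (Suc y)" "int (d a)" "int (d b)" "int m"] lt eq by simp
  next
    case 2
    then show ?thesis
      using lex_less[of "int (Suc y)" "int (Suc x)" "int (d b)" "int (d a)" "int m"] lt eq by simp
  next
    case 3
    \<comment> \<open>With equal \<open>x\<close> and \<open>y\<close>, equal counts would force
      \<open>a = b\<close>. So the later up step has strictly more down steps before it and starts
      lower.\<close>
    then have "d a \<noteq> d b" using le assms(2) xy by auto
    then show ?thesis using 3 eq le(3) by simp
  qed
  then show "spitzer_height q m a (d a) < spitzer_height q m b (d b) \<longleftrightarrow> a - q * d a < b - q * d b"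
    "spitzer_height q m a (d a) \<noteq> spitzer_height q m b (d b)" using xy by blast+
qed

text \<open>Ranking speaks only of pairs \<open>a < b\<close>; the reversed pairs follow by negation
  because neither letters nor heights have ties.\<close>

lemma ranked_down_counts_iff:
  assumes d: "down_counts q (q * m) d" and w: "distinct w" "length w = q * m"
  shows "(\<forall>a < q * m. \<forall>b < q * m. w ! a < w ! b \<longleftrightarrow>
      spitzer_height q m a (d a) < spitzer_height q m b (d b)) \<longleftrightarrow>
    ranked w (map (\<lambda>a. a - q * d a) [0..<q * m])"
proof -
  let ?z = "\<lambda>a. spitzer_height q m a (d a)"
  have "ranked w (map (\<lambda>a. a - q * d a) [0..<q * m]) \<longleftrightarrow>
      (\<forall>b < q * m. \<forall>a < b. w ! a < w ! b \<longleftrightarrow> ?z a < ?z b)"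
    using w(2) spitzer_height_less_iff(1)[OF d] by (auto simp: ranked_iff_nth)
  also have "\<dots> \<longleftrightarrow> (\<forall>a < q * m. \<forall>b < q * m. w ! a < w ! b \<longleftrightarrow> ?z a < ?z b)"
  proof (rule iffI; intro allI impI)
    fix a b assume *: "\<forall>b < q * m. \<forall>a < b. w ! a < w ! b \<longleftrightarrow> ?z a < ?z b"
      and ab: "a < q * m" "b < q * m"
    consider "a < b" | "a = b" | "b < a" by linarith
    then show "w ! a < w ! b \<longleftrightarrow> ?z a < ?z b"
    proof cases
      case 3
      then have "w ! a \<noteq> w ! b" using w ab by (simp add: nth_eq_iff_index_eq)
      then have "w ! a < w ! b \<longleftrightarrow> \<not> w ! b < w ! a" by auto
      also have "\<dots> \<longleftrightarrow> ?z a < ?z b"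
        using * 3 ab spitzer_height_less_iff(2)[OF d 3 ab(1)] by auto
      finally show ?thesis .
    qed (use * ab in auto)
  qed auto
  finally show ?thesis by blast
qed

section \<open>Dyck heights with down steps of size \<open>q\<close>\<close>

lemma lift_Suc_mono_le_bounded:
  fixes d :: "nat \<Rightarrow> 'a::preorder"
  assumes "\<And>i. Suc i < N \<Longrightarrow> d i \<le> d (Suc i)" "a \<le> b" "b < N"
  shows "d a \<le> d b"
  using assms(2,3)
proof (induction b rule: dec_induct)
  case (step b)
  then show ?case using assms(1)[of b] order_trans by auto
qed simp

text \<open>The congruence is what allows solving \<open>h ! a = a - q * d a\<close> for a natural
  number \<open>d a\<close>. Under this substitution, heights rising by at most one correspond to
  counts that do not decrease.\<close>

lemma dyck_heights_mod_iff:
  assumes "0 < q" "length h = N"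
  shows "dyck_heights 0 h \<and> (\<forall>i < N. h ! i mod q = i mod q) \<longleftrightarrow>
    (\<exists>d. down_counts q N d \<and> h = map (\<lambda>a. a - q * d a) [0..<N])"
proof
  assume h: "dyck_heights 0 h \<and> (\<forall>i < N. h ! i mod q = i mod q)"
  then have step: "h ! Suc i \<le> Suc (h ! i)" if "Suc i < N" for i
    using that assms(2) by (auto simp: dyck_heights_def successively_conv_nth)
  have zero: "h ! 0 = 0" if "0 < N"
    using that assms(2) h by (auto simp: dyck_heights_def hd_conv_nth)
  have le: "h ! i \<le> i" if "i < N" for i
    using that by (induction i) (use zero step le_trans in force)+
  define d where "d a = (a - h ! a) div q" for a
  have qd: "q * d a = a - h ! a" if "a < N" for a
  proof -
    have "q dvd a - h ! a" using h le that by (metis mod_eq_dvd_iff_nat)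
    then show ?thesis by (simp add: d_def)
  qed
  have "d i \<le> d (Suc i)" if "Suc i < N" for i
  proof -
    have "i - h ! i \<le> Suc i - h ! Suc i" using step[OF that] le[OF that] by linarith
    then show ?thesis by (simp add: d_def div_le_mono)
  qed
  then have "d a \<le> d b" if "a < b" "b < N" for a b
    using lift_Suc_mono_le_bounded[of N d a b] that by auto
  then have "down_counts q N d" using qd by (auto simp: down_counts_def)
  moreover have "h = map (\<lambda>a. a - q * d a) [0..<N]"
    using qd le assms(2) by (intro nth_equalityI) auto
  ultimately show "\<exists>d. down_counts q N d \<and> h = map (\<lambda>a. a - q * d a) [0..<N]" by blast
next
  assume "\<exists>d. down_counts q N d \<and> h = map (\<lambda>a. a - q * d a) [0..<N]"
  then obtain d where d: "down_counts q N d" and h: "h = map (\<lambda>a. a - q * d a) [0..<N]" by blast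
  have "Suc i - q * d (Suc i) \<le> Suc (i - q * d i)" if "Suc i < N" for i
  proof -
    have "q * d i \<le> q * d (Suc i)" "q * d i \<le> i" using d that by (auto simp: down_counts_def)
    then show ?thesis by linarith
  qed
  then have "dyck_heights 0 h"
    by (auto simp: dyck_heights_def successively_conv_nth h hd_map)
  moreover have "(a - q * d a) mod q = a mod q" if "a < N" for a
  proof -
    have "a = a - q * d a + q * d a" using d that by (simp add: down_counts_def)
    then show ?thesis by (metis mod_mult_self2)
  qed
  ultimately show "dyck_heights 0 h \<and> (\<forall>i < N. h ! i mod q = i mod q)"
    using h by auto
qed

section \<open>Passage between paths and down counts\<close>

lemma filter_upt_nth:
  assumes "a < length (filter P [s..<e])"
  shows "length (filter P [s..<filter P [s..<e] ! a]) = a"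
  using assms
proof (induction e)
  case (Suc e)
  then show ?case
    by (cases "s \<le> e") (auto simp: nth_append less_Suc_eq split: if_splits)
qed simp

text \<open>Heights depend only on the numbers of up and down steps made so far, and positivity of
  the path at its up steps bounds the down counts.\<close>

lemma down_counts_of_path:
  assumes path: "catalan_spitzer_path (Suc q) m z" and pos: "0 < q" "0 < m"
  shows "\<exists>d. down_counts q (q * m) d \<and>
    (\<forall>a < q * m. z ! (ascent_indices (Suc q) m z ! a) = spitzer_height q m a (d a))"
proof -
  let ?M = "Suc q * m + 1"
  define up where "up i \<longleftrightarrow> z ! i < z ! Suc i" for i
  define u where "u i = length (filter up [0..<i])" for i
  define f where "f a = ascent_indices (Suc q) m z ! a" for a
  have up_iff: "up i \<longleftrightarrow> up_step m z i" if "i < ?M" for i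
  proof -
    have "up_step m z i \<or> down_step (Suc q) m z i"
      using path that by (auto simp: catalan_spitzer_path_def)
    moreover have "up i" if "up_step m z i" using that pos by (simp add: up_def up_step_def)
    moreover have "\<not> up i" if "down_step (Suc q) m z i"
      using that by (auto simp: up_def down_step_def not_less simp flip: of_nat_mult)
    ultimately show ?thesis by blast
  qed
  have z: "z ! i = int m * int (u i) - (int q * int m + 1) * (int i - int (u i))" if "i \<le> ?M" for i
    using that
  proof (induction i)
    case 0
    then show ?case using path by (simp add: catalan_spitzer_path_def u_def)
  next
    case (Suc i)
    then have i: "i < ?M" by simp
    then consider "up i" "up_step m z i" | "\<not> up i" "down_step (Suc q) m z i"
      using path up_iff by (auto simp: catalan_spitzer_path_def)
    then show ?case
      using Suc i by cases (auto simp: u_def up_step_def down_step_def algebra_simps)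
  qed
  \<comment> \<open>The first step is up because \<open>z ! 1\<close> is positive.
    \<open>ascent_indices\<close> starts at 1 and omits it, hence \<open>Suc a\<close> rather than
    \<open>a\<close> up steps before \<open>f a\<close>.\<close>
  have up0: "up 0"
    using path pos by (auto simp: catalan_spitzer_path_def up_def Suc_le_eq)
  have cons: "[0..<Suc n] = 0 # [1..<Suc n]" for n by (simp add: upt_conv_Cons del: upt_Suc)
  have asc: "ascent_indices (Suc q) m z = filter up [1..<?M]"
    by (simp add: ascent_indices_def up_def[abs_def])
  have len: "length (filter up [1..<?M]) = q * m"
  proof -
    have "length (filter up [0..<?M]) = card (set (filter up [0..<?M]))"
      by (simp only: distinct_card distinct_filter distinct_upt)
    also have "set (filter up [0..<?M]) = {i. i < ?M \<and> up_step m z i}"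
      using up_iff by (auto simp del: upt_Suc)
    also have "card \<dots> = q * m + 1" using path by (simp add: catalan_spitzer_path_def)
    finally show ?thesis using up0 cons[of "Suc q * m"] by (simp del: upt_Suc)
  qed
  have f_in: "f a \<in> {1..Suc q * m}" if "a < q * m" for a
    using nth_mem[of a "filter up [1..<?M]"] that len by (auto simp: f_def asc)
  have uf: "u (f a) = Suc a" if a: "a < q * m" for a
  proof -
    obtain n where n: "f a = Suc n" using f_in[OF a] by (cases "f a") auto
    have "length (filter up [1..<f a]) = a"
      using filter_upt_nth[of a up 1 ?M] a len by (simp add: f_def asc)
    then show ?thesis using up0 cons[of n] by (simp add: u_def n del: upt_Suc)
  qed
  \<comment> \<open>Of the \<open>f a\<close> steps before this up step, \<open>Suc a\<close> are up
    steps.\<close>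
  define d where "d a = f a - Suc a" for a
  have fd: "f a = Suc a + d a" if "a < q * m" for a
  proof -
    have "u (f a) \<le> f a" unfolding u_def using length_filter_le[of up "[0..<f a]"] by simp
    then show ?thesis using uf[OF that] by (simp add: d_def)
  qed
  have zf: "z ! f a = spitzer_height q m a (d a)" if "a < q * m" for a
    using z[of "f a"] f_in[OF that] uf[OF that] fd[OF that]
    by (simp add: spitzer_height_def algebra_simps)
  \<comment> \<open>Otherwise \<open>a + 1 \<le> q * d a\<close>, and the height would be at most
    \<open>- d a\<close>.\<close>
  have "q * d a \<le> a" if "a < q * m" for a
  proof (rule ccontr)
    assume "\<not> q * d a \<le> a"
    then have "int a + 1 \<le> int q * int (d a)" by (simp flip: of_nat_mult)
    then have "int m * (int a + 1) \<le> int m * (int q * int (d a))" by (intro mult_left_mono) auto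
    moreover have "0 < z ! f a" using path f_in[OF that] by (auto simp: catalan_spitzer_path_def)
    ultimately show False
      using zf[OF that] by (simp add: spitzer_height_def algebra_simps)
  qed
  moreover have "d a \<le> d b" if "a < b" "b < q * m" for a b
  proof -
    have "f a' < f (Suc a')" if "Suc a' < q * m" for a'
      using sorted_wrt_nth_less[of "(<)" "filter up [1..<?M]" a' "Suc a'"] that len
      by (auto simp: f_def asc sorted_wrt_filter simp del: upt_Suc)
    then have "d a' \<le> d (Suc a')" if "Suc a' < q * m" for a'
      using that fd[of a'] fd[of "Suc a'"] by fastforce
    then show ?thesis using lift_Suc_mono_le_bounded[of "q * m" d a b] that by auto
  qed
  ultimately show ?thesis using zf unfolding down_counts_def f_def by blast
qed

text \<open>The path is built from the set \<open>I\<close> of positions of its up steps: the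
  initial one, and \<open>f a\<close>, which has \<open>Suc a\<close> up and \<open>d a\<close> down
  steps before it. The height \<open>ht\<close> then follows by counting.\<close>

lemma path_of_down_counts:
  assumes d: "down_counts q (q * m) d" and pos: "0 < q" "0 < m"
  shows "\<exists>z. catalan_spitzer_path (Suc q) m z \<and>
    (\<forall>a < q * m. z ! (ascent_indices (Suc q) m z ! a) = spitzer_height q m a (d a))"
proof -
  let ?M = "Suc q * m + 1"
  define f where "f a = Suc a + d a" for a
  define I where "I = insert 0 (f ` {..<q * m})"
  define u where "u i = card (I \<inter> {..<i})" for i
  define ht where "ht i = int m * int (u i) - (int q * int m + 1) * (int i - int (u i))" for i
  define z where "z = map ht [0..<Suc q * m + 2]"
  have mono: "f a < f b" if "a < b" "b < q * m" for a b
    using d that by (auto simp: f_def down_counts_def intro: add_less_le_mono)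
  have inj: "inj_on f {..<q * m}"
    by (intro inj_onI) (metis lessThan_iff mono linorder_neqE_nat less_irrefl)
  have qd: "q * d a \<le> a" "d a < m" if "a < q * m" for a
    using d that down_count_less by (auto simp: down_counts_def)
  have I_sub: "I \<subseteq> {..<?M}" using qd by (fastforce simp: I_def f_def)
  \<comment> \<open>Counts the up steps before \<open>i\<close> when the first \<open>a\<close>
    values of \<open>f\<close>, and no others, lie below \<open>i\<close>.\<close>
  have prefix: "u i = Suc a"
    if "0 < i" "a \<le> q * m" "\<And>b. b < a \<Longrightarrow> f b < i" "\<And>b. a \<le> b \<Longrightarrow> b < q * m \<Longrightarrow> i \<le> f b" for i a
  proof -
    have "I \<inter> {..<i} = insert 0 (f ` {..<a})"
      using that by (fastforce simp: I_def not_less[symmetric])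
    moreover have "card (f ` {..<a}) = a"
      using inj_on_subset[OF inj, of "{..<a}"] that(2) by (simp add: card_image)
    moreover have "0 \<notin> f ` {..<a}" by (auto simp: f_def)
    ultimately show ?thesis by (simp add: u_def)
  qed
  have u_Suc: "u (Suc i) = (if i \<in> I then Suc (u i) else u i)" for i
  proof -
    have "I \<inter> {..<Suc i} = (if i \<in> I then insert i (I \<inter> {..<i}) else I \<inter> {..<i})"
      by (auto simp: less_Suc_eq)
    then show ?thesis by (auto simp: u_def)
  qed
  have z_nth: "z ! i = ht i" if "i \<le> ?M" for i using that by (simp add: z_def del: upt_Suc)
  have up: "up_step m z i \<longleftrightarrow> i \<in> I" and down: "down_step (Suc q) m z i \<longleftrightarrow> i \<notin> I"
    and asc: "z ! i < z ! Suc i \<longleftrightarrow> i \<in> I" if "i < ?M" for i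
  proof -
    have "z ! Suc i = (if i \<in> I then z ! i + int m else z ! i - (int q * int m + 1))"
      using that z_nth[of i] z_nth[of "Suc i"] u_Suc[of i] by (auto simp: ht_def algebra_simps)
    then have "z ! Suc i = (if i \<in> I then z ! i + int m else z ! i - (int (q * m) + 1))" by simp
    then show "up_step m z i \<longleftrightarrow> i \<in> I" "down_step (Suc q) m z i \<longleftrightarrow> i \<notin> I"
      "z ! i < z ! Suc i \<longleftrightarrow> i \<in> I"
      using pos by (auto simp: up_step_def down_step_def simp del: of_nat_mult)
  qed
  have card_I: "card I = q * m + 1"
  proof -
    have "0 \<notin> f ` {..<q * m}" by (auto simp: f_def)
    then show ?thesis using inj by (simp add: I_def card_image)
  qed
  have last: "u ?M = q * m + 1" using I_sub card_I by (simp add: u_def Int_absorb2)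
  have uf: "u (f a) = Suc a" if "a < q * m" for a
    using prefix[of "f a" a] mono that by (force simp: f_def le_less)
  have zf: "z ! f a = spitzer_height q m a (d a)" if "a < q * m" for a
  proof -
    have "f a \<le> ?M" using I_sub that by (force simp: I_def)
    then show ?thesis using uf[OF that] z_nth
      by (simp add: ht_def spitzer_height_def) (simp add: f_def algebra_simps)
  qed
  \<comment> \<open>Up to the next up step \<open>f a\<close> the path only falls, so it suffices
    that the height there is positive; this holds since \<open>q * d a \<le> a\<close> and
    \<open>d a < m\<close>.\<close>
  have height_pos: "0 < z ! i" if i: "i \<in> {1..Suc q * m}" for i
  proof (cases "\<exists>a < q * m. i \<le> f a")
    case True
    define a where "a = (LEAST a. a < q * m \<and> i \<le> f a)"
    have a: "a < q * m" "i \<le> f a" using LeastI_ex[OF True] by (auto simp: a_def)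
    have "f b < i" if "b < a" for b
      using not_less_Least[of b "\<lambda>a. a < q * m \<and> i \<le> f a"] that a by (auto simp: a_def)
    moreover have "i \<le> f b" if "a \<le> b" "b < q * m" for b
      using a(2) mono[of a b] that by (cases "a = b") auto
    ultimately have ui: "u i = Suc a"
      using a(1) i by (intro prefix) auto
    have "0 < int m * int (Suc (a - q * d a)) - int (d a)"
    proof -
      have "int m * 1 \<le> int m * int (Suc (a - q * d a))" by (intro mult_left_mono) auto
      then show ?thesis using qd[OF a(1)] by linarith
    qed
    also have "\<dots> = spitzer_height q m a (d a)" using qd[OF a(1)] by (simp add: spitzer_height_eq)
    also have "\<dots> \<le> z ! i"
    proof -
      have "(int q * int m + 1) * (int i - int (u i)) \<le> (int q * int m + 1) * int (d a)"
        using a ui by (intro mult_left_mono) (auto simp: f_def)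
      then show ?thesis using i z_nth[of i] ui by (simp add: ht_def spitzer_height_def algebra_simps)
    qed
    finally show ?thesis .
  next
    case False
    \<comment> \<open>No up step is left: the path falls straight to 0 at \<open>?M\<close>, so the
      height is the down step size times the number of remaining steps.\<close>
    then have "u i = Suc (q * m)" using i by (intro prefix) (auto simp: not_le)
    then have "z ! i = (int q * int m + 1) * (int ?M - int i)"
      using i z_nth[of i] by (simp add: ht_def algebra_simps)
    moreover have "0 < int q * int m + 1" by (simp add: add_nonneg_pos)
    moreover have "0 < int ?M - int i" using i by (simp flip: of_nat_mult of_nat_add)
    ultimately show ?thesis by (simp only: mult_pos_pos)
  qed
  have "{i. i < ?M \<and> up_step m z i} = I" using up I_sub by auto
  moreover have "{i. i < ?M \<and> down_step (Suc q) m z i} = {..<?M} - I" using down by auto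
  moreover have "card ({..<?M} - I) = m"
    using I_sub card_I by (subst card_Diff_subset) (auto simp: finite_subset)
  ultimately have "catalan_spitzer_path (Suc q) m z"
    unfolding catalan_spitzer_path_def
    using card_I up down height_pos last z_nth[of 0] z_nth[of ?M]
    by (auto simp: ht_def u_def z_def algebra_simps simp del: upt_Suc)
  moreover have "ascent_indices (Suc q) m z = map f [0..<q * m]"
  proof (rule sorted_distinct_set_unique)
    show "sorted (map f [0..<q * m])"
      using mono by (auto simp: sorted_iff_nth_mono_less intro: less_imp_le)
    have "set (ascent_indices (Suc q) m z) = {i \<in> {1..<?M}. i \<in> I}"
      using asc by (auto simp: ascent_indices_def)
    also have "\<dots> = f ` {..<q * m}" using I_sub by (auto simp: I_def f_def)
    finally show "set (ascent_indices (Suc q) m z) = set (map f [0..<q * m])"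
      by (simp add: atLeast0LessThan)
  qed (use inj in \<open>auto simp: ascent_indices_def distinct_map atLeast0LessThan
      sorted_wrt_filter simp del: upt_Suc\<close>)
  ultimately show ?thesis using zf by auto
qed

section \<open>Short permutations in terms of Dyck heights\<close>

lemma short_catalan_spitzer_permutation_iff:
  assumes "0 < q"
  shows "short_catalan_spitzer_permutation (Suc q) m w \<longleftrightarrow>
    w \<in> permutations_of_set {1..q * m} \<and>
    (\<exists>h. ranked w h \<and> dyck_heights 0 h \<and> (\<forall>i < length h. h ! i mod q = i mod q))"
proof (cases "m = 0")
  case True
  \<comment> \<open>For order 0 up steps are level, so they cannot be recognised as ascents; the
    path \<open>[0, 0]\<close> and the empty word are treated by hand.\<close>
  have "{i. i = 0 \<and> up_step 0 [0, 0] i} = {0}" "{i. i = 0 \<and> down_step (Suc q) 0 [0, 0] i} = {}"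
    by (auto simp: up_step_def down_step_def)
  then have "catalan_spitzer_path (Suc q) 0 [0, 0]"
    by (simp add: catalan_spitzer_path_def up_step_def)
  then have "short_catalan_spitzer_permutation (Suc q) m w \<longleftrightarrow> w = []"
    using True by (auto simp: short_catalan_spitzer_permutation_def short_permutation_of_path_def)
  moreover have "ranked [] []" "dyck_heights 0 []" by (simp_all add: ranked_def dyck_heights_def)
  ultimately show ?thesis using True by (auto intro!: exI[where x = "[]"])
next
  case False
  let ?N = "q * m"
  have "short_catalan_spitzer_permutation (Suc q) m w \<longleftrightarrow> w \<in> permutations_of_set {1..?N} \<and>
      (\<exists>d. down_counts q ?N d \<and> (\<forall>a < ?N. \<forall>b < ?N. w ! a < w ! b \<longleftrightarrow>
        spitzer_height q m a (d a) < spitzer_height q m b (d b)))"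
    (is "?S \<longleftrightarrow> ?P \<and> (\<exists>d. _ \<and> ?O d)")
  proof
    assume ?S
    then obtain z where z: "catalan_spitzer_path (Suc q) m z"
        "short_permutation_of_path (Suc q) m z w"
      by (auto simp: short_catalan_spitzer_permutation_def)
    from down_counts_of_path[OF z(1)] assms False
    obtain d where "down_counts q ?N d"
      "\<forall>a < ?N. z ! (ascent_indices (Suc q) m z ! a) = spitzer_height q m a (d a)" by blast
    then show "?P \<and> (\<exists>d. down_counts q ?N d \<and> ?O d)"
      using z(2) by (auto simp: short_permutation_of_path_def)
  next
    assume *: "?P \<and> (\<exists>d. down_counts q ?N d \<and> ?O d)"
    then obtain d where d: "down_counts q ?N d" "?O d" by blast
    from path_of_down_counts[OF d(1)] assms False
    obtain z where "catalan_spitzer_path (Suc q) m z"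
      "\<forall>a < ?N. z ! (ascent_indices (Suc q) m z ! a) = spitzer_height q m a (d a)" by blast
    then show ?S
      using * d(2) by (auto simp: short_catalan_spitzer_permutation_def short_permutation_of_path_def)
  qed
  also have "\<dots> \<longleftrightarrow> ?P \<and> (\<exists>d. down_counts q ?N d \<and> ranked w (map (\<lambda>a. a - q * d a) [0..<?N]))"
  proof (intro conj_cong refl ex_cong1)
    fix d assume "?P" "down_counts q ?N d"
    then show "?O d \<longleftrightarrow> ranked w (map (\<lambda>a. a - q * d a) [0..<?N])"
      using length_finite_permutations_of_set[of w "{1..?N}"]
      by (intro ranked_down_counts_iff) (auto simp: permutations_of_setD)
  qed
  also have "\<dots> \<longleftrightarrow> ?P \<and> (\<exists>h. length h = ?N \<and> ranked w h \<and>
      (\<exists>d. down_counts q ?N d \<and> h = map (\<lambda>a. a - q * d a) [0..<?N]))"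
  proof -
    have "length (map (\<lambda>a. a - q * d a) [0..<?N]) = ?N" for d by simp
    then show ?thesis by blast
  qed
  also have "\<dots> \<longleftrightarrow> ?P \<and> (\<exists>h. length h = ?N \<and> ranked w h \<and> dyck_heights 0 h \<and>
      (\<forall>i < ?N. h ! i mod q = i mod q))"
    by (intro conj_cong refl ex_cong1 dyck_heights_mod_iff[OF assms, symmetric])
  also have "\<dots> \<longleftrightarrow> ?P \<and> (\<exists>h. ranked w h \<and> dyck_heights 0 h \<and>
      (\<forall>i < length h. h ! i mod q = i mod q))"
  proof (rule conj_cong[OF refl], rule ex_cong1)
    fix h assume "?P"
    then have "length h = ?N" if "ranked w h"
      using that length_finite_permutations_of_set[of w "{1..?N}"] by (simp add: ranked_def)
    then show "length h = ?N \<and> ranked w h \<and> dyck_heights 0 h \<and> (\<forall>i < ?N. h ! i mod q = i mod q) \<longleftrightarrow>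
        ranked w h \<and> dyck_heights 0 h \<and> (\<forall>i < length h. h ! i mod q = i mod q)"
      by (cases "ranked w h") simp_all
  qed
  finally show ?thesis .
qed

theorem theorem4p13:
  fixes n :: nat and \<sigma> :: "nat list"
  assumes "\<sigma> \<in> permutations_of_set {1..n}"
  shows "(short_catalan_spitzer_permutation 2 n \<sigma> \<longleftrightarrow> levelwise_numbered (foata_strehl \<sigma>)) \<and>
    (\<forall>k \<ge> 2. (\<exists>m. short_catalan_spitzer_permutation k m \<sigma>) \<longleftrightarrow>
       levelwise_numbered (foata_strehl \<sigma>) \<and>
       (\<forall>vs. maximal_right_path (foata_strehl \<sigma>) vs \<longrightarrow> (k - 1) dvd length vs))"
proof -
  let ?t = "foata_strehl \<sigma>"
  have \<sigma>: "distinct \<sigma>" "set \<sigma> = {1..n}" "length \<sigma> = n"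
    using assms by (auto simp: permutations_of_set_def dest: distinct_card)
  have size: "size ?t = n"
    using inorder_foata_strehl[OF \<sigma>(1)] \<sigma>(3) by (metis length_inorder)
  have perm: "\<sigma> \<in> permutations_of_set {1..N} \<longleftrightarrow> N = n" for N
    using assms \<sigma>(3) by (metis length_finite_permutations_of_set card_atLeastAtMost diff_Suc_1)
  \<comment> \<open>The levels of the tree are the only candidate for the heights, which removes the
    existential quantifier over \<open>h\<close>.\<close>
  have levels: "ranked \<sigma> h \<and> dyck_heights 0 h \<longleftrightarrow> ranked \<sigma> (levels ?t) \<and> h = levels ?t" for h
  proof -
    have "map ((+) 0) (levels ?t) = levels ?t" by (simp add: map_idI)
    then show ?thesis
      using levels_foata_strehl[OF \<sigma>(1), of h 0] dyck_heights_levels[of ?t] by auto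
  qed
  have short: "short_catalan_spitzer_permutation (Suc q) m \<sigma> \<longleftrightarrow>
      q * m = n \<and> levelwise_numbered ?t \<and> (\<forall>i < size ?t. levels ?t ! i mod q = i mod q)"
    if "0 < q" for q m
    unfolding short_catalan_spitzer_permutation_iff[OF that] perm
      levelwise_numbered_iff_ranked[OF assms]
    using levels by (metis length_levels)
  \<comment> \<open>Modulo 1 the congruences are vacuous.\<close>
  have "short_catalan_spitzer_permutation 2 n \<sigma> \<longleftrightarrow> levelwise_numbered ?t"
    using short[of 1 n] by (simp add: numeral_2_eq_2)
  moreover have "(\<exists>m. short_catalan_spitzer_permutation k m \<sigma>) \<longleftrightarrow> levelwise_numbered ?t \<and>
      (\<forall>vs. maximal_right_path ?t vs \<longrightarrow> (k - 1) dvd length vs)" if k2: "2 \<le> k" for k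
  proof -
    obtain q where k: "k = Suc q" "0 < q" using k2 by (cases k) auto
    \<comment> \<open>The order \<open>m\<close> is the quotient of \<open>n\<close> by
      \<open>q\<close>, which exists because divisibility of all maximal paths includes
      \<open>q dvd size ?t\<close>.\<close>
    then show ?thesis
      unfolding maximal_right_paths_dvd_iff size
      using short[OF k(2)] size by (auto simp: dvd_def) metis
  qed
  ultimately show ?thesis by blast
qed

end
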